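(* Let $\sigma\in Av(T_1)$ be a permutation whose last entry is not its maximum entry. If the $y$-coordinate of the last point of the Dyck prefix $\Phi_1(\sigma)$ is $2k-2$, then the longest decreasing subsequence of $\sigma$ has length $k$.
   Context: A permutation $\sigma$ avoids $\tau$ if no subsequence of $\sigma$ has the same relative order as $\tau$. $T_1=\{3214,3241,4213,4231\}$, $Av(T_1)$ is the set of permutations avoiding all four patterns, $S_n(T_1)=Av(T_1)\cap S_n$. A Dyck prefix is a lattice path from the origin with steps $U=(1,1)$, $D=(1,-1)$ never going below the $x$-axis. The map $\Phi_1$ on $Av(T_1)$: $\Phi_1(1)$ is the empty path; for $n\ge1$ and $\sigma\in S_{n+1}(T_1)$, write $\sigma=M_1w_1\cdots M_kw_k$ with $M_1<\cdots<M_k=n+1$ the left-to-right maxima (entries larger than all preceding ones) and $w_i$ possibly empty words of lengths $l_i$, $M_0=0$. If $w_k$ is empty, $\Phi_1(\sigma)=U^{M_1-M_0}D^{l_1+1}\cdots U^{M_{k-1}-M_{k-2}}D^{l_{k-1}+1}$; if $w_k=x_1\cdots x_{l_k}$ is nonempty, $\Phi_1(\sigma)=U^{M_1-M_0}D^{l_1+1}\cdots U^{M_{k-1}-M_{k-2}}D^{l_{k-1}+1}U^{M_k-M_{k-1}}Q_1\cdots Q_{l_k-1}$ with $Q_j=U$ if $x_j=\max\{x_j,\dots,x_{l_k}\}$ and $Q_j=D$ otherwise. *)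

theory Defs
  imports Complex_Main "HOL-Library.Sublist" "HOL-Library.Product_Plus"
    "HOL-Combinatorics.Multiset_Permutations"
begin

text \<open>A permutation of \<open>{1..n}\<close> is given by its one-line notation, an element of
  \<^term>\<open>permutations_of_set {1..n}\<close>.\<close>

definition order_isomorphic :: "nat list \<Rightarrow> nat list \<Rightarrow> bool" where
  "order_isomorphic xs ys \<longleftrightarrow> length xs = length ys \<and>
     (\<forall>i<length xs. \<forall>j<length xs. xs ! i < xs ! j \<longleftrightarrow> ys ! i < ys ! j)"

definition avoids :: "nat list \<Rightarrow> nat list \<Rightarrow> bool" where
  "avoids \<sigma> \<tau> \<longleftrightarrow> \<not> (\<exists>xs. subseq xs \<sigma> \<and> order_isomorphic xs \<tau>)"

definition Av :: "nat list set \<Rightarrow> nat list set" where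
  "Av T = {\<sigma>. (\<exists>n. \<sigma> \<in> permutations_of_set {1..n}) \<and> (\<forall>\<tau>\<in>T. avoids \<sigma> \<tau>)}"

definition T1 :: "nat list set" where
  "T1 = {[3,2,1,4], [3,2,4,1], [4,2,1,3], [4,2,3,1]}"

definition longest_decreasing :: "nat list \<Rightarrow> nat" where
  "longest_decreasing \<sigma> = Max {length xs | xs. subseq xs \<sigma> \<and> sorted_wrt (>) xs}"

definition is_ltr_max :: "nat list \<Rightarrow> nat \<Rightarrow> bool" where
  "is_ltr_max \<sigma> i \<longleftrightarrow> i < length \<sigma> \<and> (\<forall>j<i. \<sigma> ! j < \<sigma> ! i)"

text \<open>The decomposition \<open>\<sigma> = M\<^sub>1 w\<^sub>1 \<dots> M\<^sub>k w\<^sub>k\<close> at the left-to-right maxima, as the list of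
  pairs \<open>(M\<^sub>i, w\<^sub>i)\<close>. The lemmas below justify the recursion: entries smaller than the current
  maximum are collected in \<open>w\<^sub>i\<close>, and the first one that is not starts the next block.\<close>

function ltr_blocks :: "nat list \<Rightarrow> (nat \<times> nat list) list" where
  "ltr_blocks [] = []"
| "ltr_blocks (x # xs) =
     (x, takeWhile (\<lambda>y. y < x) xs) # ltr_blocks (dropWhile (\<lambda>y. y < x) xs)"
  by pat_completeness auto
termination
  by (relation "measure length") (auto simp: le_imp_less_Suc length_dropWhile_le)

lemma concat_ltr_blocks: "concat (map (\<lambda>(M, w). M # w) (ltr_blocks \<sigma>)) = \<sigma>"
  by (induction \<sigma> rule: ltr_blocks.induct) auto

lemma ltr_maxima_Cons:
  assumes "distinct (x # xs)"
  shows "map ((!) (x # xs)) (filter (is_ltr_max (x # xs)) [0..<length (x # xs)]) =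
    x # (let ys = dropWhile (\<lambda>y. y < x) xs
         in map ((!) ys) (filter (is_ltr_max ys) [0..<length ys]))"
proof -
  define as where "as = takeWhile (\<lambda>y. y < x) xs"
  define ys where "ys = dropWhile (\<lambda>y. y < x) xs"
  let ?s = "x # as @ ys" and ?n = "Suc (length as)"
  have xs: "xs = as @ ys" by (simp add: as_def ys_def)
  have as: "y < x" if "y \<in> set as" for y
    using that by (auto simp: as_def dest: set_takeWhileD)
  have hd_ys: "x < ys ! 0" if "ys \<noteq> []"
  proof -
    have "\<not> hd ys < x" using that hd_dropWhile unfolding ys_def by blast
    moreover have "hd ys \<noteq> x" using assms that xs by (cases ys) auto
    ultimately show ?thesis using that by (simp add: hd_conv_nth)
  qed
  have no: "\<not> is_ltr_max ?s i" if "i \<in> {1..<?n}" for i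
  proof -
    have "?s ! i \<in> set as" using that by (cases i) (auto simp: nth_append)
    then have "?s ! i < ?s ! 0" using as by simp
    then show ?thesis using that unfolding is_ltr_max_def by force
  qed
  have shift: "?s ! (i + ?n) = ys ! i" for i by (simp add: nth_append)
  have small: "?s ! j \<le> x" if "j < ?n" for j
    using that as by (cases j) (auto simp: nth_append less_imp_le)
  have yes: "is_ltr_max ?s (i + ?n) \<longleftrightarrow> is_ltr_max ys i" if i: "i < length ys" for i
  proof
    assume L: "is_ltr_max ?s (i + ?n)"
    show "is_ltr_max ys i" unfolding is_ltr_max_def
    proof (intro conjI allI impI)
      fix j assume "j < i"
      then have "j + ?n < i + ?n" by simp
      then have "?s ! (j + ?n) < ?s ! (i + ?n)" using L unfolding is_ltr_max_def by blast
      then show "ys ! j < ys ! i" unfolding shift .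
    qed (rule i)
  next
    assume R: "is_ltr_max ys i"
    have "ys ! 0 \<le> ys ! i" using R unfolding is_ltr_max_def by (cases "i = 0") auto
    moreover have "x < ys ! 0" using i by (intro hd_ys) auto
    ultimately have big: "x < ys ! i" by simp
    show "is_ltr_max ?s (i + ?n)" unfolding is_ltr_max_def
    proof (intro conjI allI impI)
      fix j assume j: "j < i + ?n"
      show "?s ! j < ?s ! (i + ?n)"
      proof (cases "j < ?n")
        case True
        then show ?thesis using small[OF True] big unfolding shift by simp
      next
        case False
        then obtain j' where j': "j = j' + ?n" by (metis le_add_diff_inverse2 not_less)
        then show ?thesis using R j unfolding j' shift is_ltr_max_def by simp
      qed
    qed (use i in simp)
  qed
  have "[0..<length ?s] = 0 # [1..<?n] @ map (\<lambda>i. i + ?n) [0..<length ys]"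
  proof -
    have "[0..<length ?s] = [0..<?n] @ [?n..<?n + length ys]"
      using upt_add_eq_append[of 0 ?n "length ys"] by simp
    moreover have "[0..<?n] = 0 # [1..<?n]" using upt_conv_Cons[of 0 ?n] by simp
    moreover have "map (\<lambda>i. i + ?n) [0..<length ys] = [?n..<?n + length ys]"
      using map_add_upt[of ?n "length ys"] by (simp only: add.commute)
    ultimately show ?thesis by (simp only: append_Cons)
  qed
  moreover have "is_ltr_max ?s 0" by (simp add: is_ltr_max_def)
  moreover have "filter (is_ltr_max ?s) [1..<?n] = []" using no by (auto simp: filter_empty_conv)
  moreover have "filter (is_ltr_max ?s) (map (\<lambda>i. i + ?n) [0..<length ys]) =
      map (\<lambda>i. i + ?n) (filter (is_ltr_max ys) [0..<length ys])"
    unfolding filter_map using yes by (intro arg_cong[where f = "map _"] filter_cong) auto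
  ultimately have "map ((!) ?s) (filter (is_ltr_max ?s) [0..<length ?s]) =
      x # map ((!) ys) (filter (is_ltr_max ys) [0..<length ys])"
    using shift by simp
  then show ?thesis unfolding ys_def[symmetric] Let_def by (simp only: xs)
qed

lemma fst_ltr_blocks:
  "distinct \<sigma> \<Longrightarrow>
     map fst (ltr_blocks \<sigma>) = map ((!) \<sigma>) (filter (is_ltr_max \<sigma>) [0..<length \<sigma>])"
proof (induction \<sigma> rule: ltr_blocks.induct)
  case (2 x xs)
  then show ?case
    unfolding ltr_maxima_Cons[OF "2.prems"] by (simp add: Let_def)
qed simp

datatype step = U | D

text \<open>A lattice path from the origin is its list of steps.\<close>

fun step_vector :: "step \<Rightarrow> int \<times> int" where
  "step_vector U = (1, 1)"
| "step_vector D = (1, -1)"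

definition last_point :: "step list \<Rightarrow> int \<times> int" where
  "last_point p = (\<Sum>s\<leftarrow>p. step_vector s)"

text \<open>The steps \<open>Q\<^sub>1 \<dots> Q\<^bsub>l-1\<^esub>\<close> read off from the last word, of length \<open>l\<close>; indices are shifted
  to start from 0.\<close>

definition last_word_steps :: "nat list \<Rightarrow> step list" where
  "last_word_steps w =
     map (\<lambda>j. if w ! j = Max (set (drop j w)) then U else D) [0..<length w - 1]"

text \<open>The first argument is the preceding left-to-right maximum \<open>M\<^bsub>i-1\<^esub>\<close>.\<close>

fun blocks_path :: "nat \<Rightarrow> (nat \<times> nat list) list \<Rightarrow> step list" where
  "blocks_path m [] = []"
| "blocks_path m [(M, w)] =
     (if w = [] then [] else replicate (M - m) U @ last_word_steps w)"
| "blocks_path m ((M, w) # b # bs) =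
     replicate (M - m) U @ replicate (length w + 1) D @ blocks_path M (b # bs)"

definition Phi1 :: "nat list \<Rightarrow> step list" where
  "Phi1 \<sigma> = blocks_path 0 (ltr_blocks \<sigma>)"

end

theory Submission
  imports Defs
begin

text \<open>The height of the last point of \<open>\<Phi>\<^sub>1(\<sigma>)\<close> is \<open>2r - 2\<close>, where \<open>r\<close> is the number of
  right-to-left maxima of \<open>\<sigma>\<close>. These form a decreasing subsequence of length \<open>r\<close>. Conversely,
  if \<open>abc\<close> is a decreasing subsequence of \<open>\<sigma>\<close>, then avoiding the patterns of \<open>T\<^sub>1\<close> says exactly
  that nothing after \<open>b\<close> exceeds \<open>b\<close>. So all entries of a decreasing subsequence except its
  first and its last are right-to-left maxima; they differ from the maximum and from the last
  entry of \<open>\<sigma>\<close>, which are two further right-to-left maxima.\<close>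

section \<open>Right-to-left maxima\<close>

fun rtl_maxima :: "'a::linorder list \<Rightarrow> 'a list" where
  "rtl_maxima [] = []"
| "rtl_maxima (x # xs) = (if \<forall>y\<in>set xs. y < x then x # rtl_maxima xs else rtl_maxima xs)"

lemma subseq_distinct: "subseq xs ys \<Longrightarrow> distinct ys \<Longrightarrow> distinct xs"
  by (metis distinct_nthsI subseq_conv_nths)

lemma subseq_rtl_maxima: "subseq (rtl_maxima xs) xs"
  by (induction xs) auto

lemma set_rtl_maxima: "set (rtl_maxima xs) \<subseteq> set xs"
  by (induction xs) auto

lemma sorted_rtl_maxima: "sorted_wrt (>) (rtl_maxima xs)"
  by (induction xs) (auto dest: subsetD[OF set_rtl_maxima])

text \<open>This lets an induction over the blocks drop a leading block: the left-to-right maximum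
  that opens the next block exceeds all its entries.\<close>

lemma rtl_maxima_append_dominated:
  assumes "\<And>x. x \<in> set xs \<Longrightarrow> \<exists>y\<in>set ys. x < y"
  shows "rtl_maxima (xs @ ys) = rtl_maxima ys"
  using assms
proof (induction xs)
  case (Cons x xs)
  obtain y where "y \<in> set ys" "x < y" using Cons.prems[of x] by auto
  then have "\<not> (\<forall>z\<in>set (xs @ ys). z < x)" by (auto intro!: bexI[of _ y])
  then show ?case using Cons by simp
qed simp

lemma in_rtl_maximaI: "\<forall>y\<in>set ys. y < x \<Longrightarrow> x \<in> set (rtl_maxima (xs @ x # ys))"
  by (induction xs) auto

lemma last_in_rtl_maxima:
  assumes "xs \<noteq> []"
  shows "last xs \<in> set (rtl_maxima xs)"
  using in_rtl_maximaI[of "[]" "last xs" "butlast xs"] assms by simp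

lemma Max_in_rtl_maxima:
  assumes "distinct xs" "xs \<noteq> []"
  shows "Max (set xs) \<in> set (rtl_maxima xs)"
proof -
  have "Max (set xs) \<in> set xs" using assms by simp
  then obtain as bs where xs: "xs = as @ Max (set xs) # bs" by (meson split_list)
  have "\<forall>y\<in>set bs. y < Max (set xs)"
  proof
    fix y assume y: "y \<in> set bs"
    then have "y \<in> set xs" by (subst xs) simp
    then have "y \<le> Max (set xs)" by simp
    moreover have "y \<noteq> Max (set xs)"
      using y assms(1) by (subst (asm) xs) auto
    ultimately show "y < Max (set xs)" by simp
  qed
  then show ?thesis using in_rtl_maximaI[of bs "Max (set xs)" as] xs by simp
qed

section \<open>Height of the end point\<close>

lemma last_point_Nil [simp]: "last_point [] = 0"
  and last_point_Cons [simp]: "last_point (s # p) = step_vector s + last_point p"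
  and last_point_append [simp]: "last_point (p @ q) = last_point p + last_point q"
  by (simp_all add: last_point_def)

lemma height_replicate [simp]:
  "snd (last_point (replicate n U)) = int n"
  "snd (last_point (replicate n D)) = - int n"
  by (induction n) auto

text \<open>Turns the indexed definition into a recursion fit for list induction. Nonemptiness of
  \<open>w\<close> matters because the final entry of a word carries no step.\<close>

lemma last_word_steps_Cons:
  assumes "w \<noteq> []"
  shows "last_word_steps (x # w) = (if x = Max (set (x # w)) then U else D) # last_word_steps w"
proof -
  obtain n where n: "length w = Suc n" using assms by (cases w) auto
  have "[0..<Suc n] = 0 # map Suc [0..<n]" by (simp add: map_Suc_upt upt_conv_Cons)
  then show ?thesis by (simp add: last_word_steps_def n del: upt_Suc)
qed

text \<open>With r right-to-left maxima among l entries, the final entry is one of them but has no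
  step. This leaves r - 1 steps \<open>U\<close> and l - r steps \<open>D\<close>.\<close>

lemma height_last_word_steps:
  assumes "distinct w" "w \<noteq> []"
  shows "snd (last_point (last_word_steps w)) = 2 * int (length (rtl_maxima w)) - int (length w) - 1"
  using assms
proof (induction w)
  case (Cons x w)
  show ?case
  proof (cases "w = []")
    case False
    \<comment> \<open>The test that selects \<open>U\<close> agrees with the test in
      \<open>rtl_maxima\<close>; distinctness gives the strict inequality.\<close>
    have "x = Max (set (x # w)) \<longleftrightarrow> (\<forall>y\<in>set w. y < x)"
    proof
      assume "x = Max (set (x # w))"
      then have "\<forall>y\<in>set w. y \<le> x" by (metis List.finite_set Max_ge list.set_intros(2))
      then show "\<forall>y\<in>set w. y < x" using Cons.prems(1) by (auto simp: order.strict_iff_order)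
    next
      assume "\<forall>y\<in>set w. y < x"
      then show "x = Max (set (x # w))" by (intro Max_eqI[symmetric]) auto
    qed
    then show ?thesis using Cons False by (simp add: last_word_steps_Cons del: list.set)
  qed (simp add: last_word_steps_def)
qed simp

text \<open>The runs of \<open>U\<close> telescope to \<open>Max (set \<sigma>) - m\<close>, and
  each block but the last descends by its length. The last block is its maximum followed by a word
  with one right-to-left maximum fewer, which accounts for the term -2. The bound on
  \<open>m\<close> keeps the truncated subtraction \<open>M - m\<close> exact, and generalising over
  \<open>m\<close> lets the induction pass to the next block.\<close>

lemma height_blocks_path:
  assumes "distinct \<sigma>" "\<sigma> \<noteq> []" "last \<sigma> \<noteq> Max (set \<sigma>)" "m \<le> hd \<sigma>"
  shows "snd (last_point (blocks_path m (ltr_blocks \<sigma>))) =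
    int (Max (set \<sigma>)) - int m - int (length \<sigma>) + 2 * int (length (rtl_maxima \<sigma>)) - 2"
  using assms
proof (induction \<sigma> arbitrary: m rule: ltr_blocks.induct)
  case (2 x xs)
  define ws ys where "ws = takeWhile (\<lambda>y. y < x) xs"
    and "ys = dropWhile (\<lambda>y. y < x) xs"
  have xs: "xs = ws @ ys" by (simp add: ws_def ys_def)
  have ws: "\<forall>y\<in>set ws. y < x" by (auto simp: ws_def dest: set_takeWhileD)
  have blocks: "ltr_blocks (x # xs) = (x, ws) # ltr_blocks ys" by (simp add: ws_def ys_def)
  show ?case
  proof (cases "ys = []")
    case True
    have Max: "Max (set (x # xs)) = x" using ws by (intro Max_eqI) (auto simp: xs True)
    \<comment> \<open>Otherwise the only entry would be both last and maximal. So the path of this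
      single block ends in \<open>last_word_steps ws\<close>.\<close>
    then have "ws \<noteq> []" using "2.prems"(3) by (auto simp: xs True)
    then show ?thesis
      using "2.prems" ws unfolding blocks Max
      by (simp add: xs True height_last_word_steps)
  next
    case False
    \<comment> \<open>The visible second block selects the equation of \<open>blocks_path\<close> in
      which the first block descends.\<close>
    then obtain b bs where b: "ltr_blocks ys = b # bs" by (cases ys) auto
    have hd: "x < hd ys"
    proof -
      have "\<not> hd ys < x" using False hd_dropWhile unfolding ys_def by blast
      moreover have "hd ys \<noteq> x" using "2.prems"(1) False by (cases ys) (auto simp: xs)
      ultimately show ?thesis by simp
    qed
    have hd_in: "hd ys \<in> set ys" using False by simp
    have dom: "\<exists>z\<in>set ys. y < z" if "y \<in> set (x # ws)" for y
      using that hd hd_in ws by (intro bexI[of _ "hd ys"]) auto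
    have rtl: "rtl_maxima (x # xs) = rtl_maxima ys"
      using rtl_maxima_append_dominated[of "x # ws" ys] dom by (simp add: xs)
    have Max: "Max (set (x # xs)) = Max (set ys)"
    proof (rule Max_eqI)
      fix y assume "y \<in> set (x # xs)"
      then consider "y \<in> set (x # ws)" | "y \<in> set ys" by (auto simp: xs)
      then show "y \<le> Max (set ys)"
      proof cases
        case 1
        then obtain z where "z \<in> set ys" "y < z" using dom by blast
        then show ?thesis by (meson List.finite_set Max_ge less_imp_le order_trans)
      qed simp
    qed (use False in \<open>auto simp: xs\<close>)
    have "last ys \<noteq> Max (set ys)" using "2.prems"(3) False unfolding Max by (simp add: xs)
    then have "snd (last_point (blocks_path x (ltr_blocks ys))) =
        int (Max (set ys)) - int x - int (length ys) + 2 * int (length (rtl_maxima ys)) - 2"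
      using "2.IH"[folded ys_def, of x] "2.prems"(1) False hd by (simp add: xs)
    then show ?thesis
      using "2.prems"(4) unfolding blocks Max rtl b by (simp add: xs)
  qed
qed simp

section \<open>Decreasing subsequences under avoidance of \<open>T1\<close>\<close>

text \<open>An entry \<open>y > b\<close> placed after \<open>b\<close> and distinct from
  \<open>a\<close> and \<open>c\<close> lies above or below \<open>a\<close> in value and before or
  after \<open>c\<close> in position: one pattern for each of the four cases.\<close>

lemma order_isomorphic_T1:
  fixes a b c y :: nat
  assumes "b < a" "c < b"
  shows "a < y \<Longrightarrow> order_isomorphic [a, b, c, y] [3, 2, 1, 4]"
    and "a < y \<Longrightarrow> order_isomorphic [a, b, y, c] [3, 2, 4, 1]"
    and "b < y \<Longrightarrow> y < a \<Longrightarrow> order_isomorphic [a, b, c, y] [4, 2, 1, 3]"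
    and "b < y \<Longrightarrow> y < a \<Longrightarrow> order_isomorphic [a, b, y, c] [4, 2, 3, 1]"
  using assms by (auto simp: order_isomorphic_def All_less_Suc2)

lemma Av_T1_middle_in_rtl_maxima:
  assumes "\<sigma> \<in> Av T1" "subseq [a, b, c] \<sigma>" "b < a" "c < b"
  shows "b \<in> set (rtl_maxima \<sigma>)"
proof -
  have dist: "distinct \<sigma>" using assms(1) by (auto simp: Av_def permutations_of_set_def)
  obtain p r where "\<sigma> = p @ a # r" "subseq [b, c] r" using assms(2) by (auto dest: list_emb_ConsD)
  moreover from this obtain q s where "r = q @ b # s" "subseq [c] s" by (auto dest: list_emb_ConsD)
  ultimately have \<sigma>: "\<sigma> = (p @ a # q) @ b # s" and c: "c \<in> set s"
    by (auto simp: subseq_singleton_left)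
  have "y < b" if y: "y \<in> set s" for y
  proof (rule ccontr)
    assume "\<not> y < b"
    then have by_lt: "b < y" and "y \<noteq> a" and "y \<noteq> c"
      using y dist assms(4) by (auto simp: \<sigma>)
    have occurs: "subseq (a # b # zs) \<sigma>" if "subseq zs s" for zs
    proof -
      have "subseq [a] (p @ a # q)" by (simp add: subseq_singleton_left)
      moreover have "subseq (b # zs) (b # s)" using that by simp
      ultimately have "subseq ([a] @ b # zs) ((p @ a # q) @ b # s)" by (rule list_emb_append_mono)
      then show ?thesis by (simp add: \<sigma>)
    qed
    have "subseq [c, y] s \<or> subseq [y, c] s"
    proof -
      obtain s1 s2 where s: "s = s1 @ c # s2" using c by (meson split_list)
      then consider "y \<in> set s1" | "y \<in> set s2" using y \<open>y \<noteq> c\<close> by auto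
      then show ?thesis
      proof cases
        case 1
        then have "subseq ([y] @ [c]) (s1 @ c # s2)"
          by (intro list_emb_append_mono) (auto simp: subseq_singleton_left)
        then show ?thesis by (simp add: s)
      next
        case 2
        then have "subseq ([] @ [c, y]) (s1 @ c # s2)"
          by (intro list_emb_append_mono) (auto simp: subseq_singleton_left)
        then show ?thesis by (simp add: s)
      qed
    qed
    then have "subseq [a, b, c, y] \<sigma> \<or> subseq [a, b, y, c] \<sigma>" using occurs by blast
    moreover have "a < y \<or> y < a" using \<open>y \<noteq> a\<close> by auto
    ultimately have "\<exists>\<tau>\<in>T1. \<not> avoids \<sigma> \<tau>"
      using order_isomorphic_T1[OF assms(3,4), of y] by_lt
      unfolding avoids_def T1_def by blast
    then show False using assms(1) by (auto simp: Av_def)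
  qed
  then show ?thesis unfolding \<sigma> by (intro in_rtl_maximaI) blast
qed

lemma Av_T1_decreasing_length_le:
  assumes "\<sigma> \<in> Av T1" "\<sigma> \<noteq> []" "last \<sigma> \<noteq> Max (set \<sigma>)"
    and "subseq ds \<sigma>" "sorted_wrt (>) ds"
  shows "length ds \<le> length (rtl_maxima \<sigma>)"
proof -
  define R where "R = set (rtl_maxima \<sigma>)"
  have dist: "distinct \<sigma>" using assms(1) by (auto simp: Av_def permutations_of_set_def)
  have card_R: "card R = length (rtl_maxima \<sigma>)"
    unfolding R_def using dist subseq_rtl_maxima by (metis distinct_card subseq_distinct)
  have extremes: "{Max (set \<sigma>), last \<sigma>} \<subseteq> R"
    using last_in_rtl_maxima Max_in_rtl_maxima dist assms(2) by (auto simp: R_def)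
  \<comment> \<open>The hypothesis on the last entry makes the two extremes distinct, which pays for
    the two ends of \<open>ds\<close>.\<close>
  have two: "card {Max (set \<sigma>), last \<sigma>} = 2" using assms(3) by auto
  have R2: "2 \<le> card R" using card_mono[OF _ extremes] two by (simp add: R_def)
  show ?thesis
  proof (cases "length ds \<le> 2")
    case False
    then obtain d ds' where "ds = d # ds'" "ds' \<noteq> []" by (cases ds) fastforce+
    \<comment> \<open>The ends \<open>d\<close> and \<open>e\<close> need not lie in
      \<open>R\<close>; they only turn each entry of \<open>mid\<close> into the middle of a
      decreasing triple.\<close>
    then obtain mid e where ds: "ds = d # mid @ [e]" by (cases ds' rule: rev_cases) auto
    have dmid: "distinct mid" using subseq_distinct[OF assms(4) dist] by (simp add: ds)
    have "set mid \<subseteq> R - {Max (set \<sigma>), last \<sigma>}"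
    proof
      fix b assume b: "b \<in> set mid"
      have lt: "b < d" "e < b" using assms(5) b by (auto simp: ds sorted_wrt_append)
      have "subseq ([d] @ [b] @ [e]) ([d] @ mid @ [e])"
        using b by (intro list_emb_append_mono) (simp_all add: subseq_singleton_left)
      then have "subseq [d, b, e] ds" by (simp add: ds)
      then have sub: "subseq [d, b, e] \<sigma>" using assms(4) by (rule subseq_order.order_trans)
      have "b \<in> R" using Av_T1_middle_in_rtl_maxima[OF assms(1) sub lt] by (simp add: R_def)
      moreover have "b \<noteq> Max (set \<sigma>)"
      proof -
        have "d \<in> set \<sigma>" by (rule list_emb_set[OF sub, of d]) auto
        then have "d \<le> Max (set \<sigma>)" by simp
        then show ?thesis using lt by simp
      qed
      moreover have "b \<noteq> last \<sigma>"
      proof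
        assume "b = last \<sigma>"
        have "subseq [b, e] \<sigma>" using sub by (rule subseq_Cons')
        then obtain us vs where "\<sigma> = us @ b # vs" "subseq [e] vs" by (auto dest: list_emb_ConsD)
        then have "vs \<noteq> []" "last \<sigma> = last vs" by (auto simp: subseq_singleton_left)
        then have "b \<in> set vs" using \<open>b = last \<sigma>\<close> by simp
        then show False using dist \<open>\<sigma> = us @ b # vs\<close> by simp
      qed
      ultimately show "b \<in> R - {Max (set \<sigma>), last \<sigma>}" by simp
    qed
    then have "card (set mid) \<le> card (R - {Max (set \<sigma>), last \<sigma>})"
      by (intro card_mono) (simp_all add: R_def)
    also have "\<dots> = card R - 2" using card_Diff_subset[OF _ extremes] two by simp
    \<comment> \<open>Here \<open>R2\<close> ensures that the natural subtraction
      \<open>card R - 2\<close> loses nothing when 2 is added back.\<close>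
    finally show ?thesis using R2 card_R distinct_card[OF dmid] by (simp add: ds)
  qed (use R2 card_R in simp)
qed

theorem theorem16:
  fixes \<sigma> :: "nat list" and k :: nat
  assumes "\<sigma> \<in> Av T1" and "\<sigma> \<noteq> []"
    and "last \<sigma> \<noteq> Max (set \<sigma>)"
    and "snd (last_point (Phi1 \<sigma>)) = 2 * int k - 2"
  shows "longest_decreasing \<sigma> = k"
proof -
  obtain n where \<sigma>: "set \<sigma> = {1..n}" "distinct \<sigma>"
    using assms(1) by (auto simp: Av_def permutations_of_set_def)
  then have n: "length \<sigma> = n" using distinct_card by fastforce
  then have "Max (set \<sigma>) = n" using assms(2) unfolding \<sigma>(1) by (intro Max_eqI) (auto simp: Suc_le_eq)
  \<comment> \<open>For a permutation of \<open>{1..n}\<close> and \<open>m = 0\<close>, the maximum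
    and the length cancel in the height formula.\<close>
  then have k: "length (rtl_maxima \<sigma>) = k"
    using height_blocks_path[OF \<sigma>(2) assms(2,3), of 0] assms(4) n by (simp add: Phi1_def)
  show ?thesis unfolding longest_decreasing_def
  proof (rule Max_eqI)
    have "{length xs |xs. subseq xs \<sigma> \<and> sorted_wrt (>) xs} \<subseteq> {..length \<sigma>}"
      by (auto dest: list_emb_length)
    then show "finite {length xs |xs. subseq xs \<sigma> \<and> sorted_wrt (>) xs}"
      by (rule finite_subset) simp
    \<comment> \<open>The right-to-left maxima themselves attain the bound.\<close>
    show "k \<in> {length xs |xs. subseq xs \<sigma> \<and> sorted_wrt (>) xs}"
      using k subseq_rtl_maxima sorted_rtl_maxima by blast
  qed (use Av_T1_decreasing_length_le[OF assms(1-3)] k in auto)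
qed

end
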